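(* Let $G$ be a connected graph with vertex set $X$ ($|X|\ge2$) and let $K$ be an edge clique cover of $G$. Then $N(K)$ is a network on $X$ that represents $G$. Moreover the set $R(N(K))$ of roots of $N(K)$ satisfies $R(N(K))\subseteq K$, and $R(N(K))=K$ if and only if $K$ does not contain two distinct sets one of which is a subset of the other. In particular, if $|K|$ is minimum (so that $|K|=\mathrm{ecc}(G)$ and $R(N(K))=K$), then $N(K)$ has the minimum number of roots among all networks on $X$ representing $G$.
   Context: A clique is a set $Y$ of vertices with $|Y|\ge2$ that are pairwise adjacent. An edge clique cover of $G$ is a set $K$ of cliques of $G$ such that every edge of $G$ is contained in some member of $K$; $\mathrm{ecc}(G)$ is the minimum size of an edge clique cover. In a digraph, a leaf is a vertex of indegree 1 and outdegree 0, a root is a vertex of indegree 0. A network on $X$ is a simple acyclic digraph $N$ whose underlying undirected graph is connected, whose set of leaves is $X$, in which every vertex of indegree 0 has outdegree at least 2, every vertex of outdegree 0 has indegree 1, and no vertex has both indegree and outdegree equal to 1. Leaves $x\ne y$ share an ancestor if some vertex has directed paths (possibly of length 0) to both. The shared ancestry graph $\mathcal A(N)$ has vertex set $X$, distinct $x,y$ adjacent iff they share an ancestor in $N$; $N$ represents $G$ if $\mathcal A(N)=G$. For a set $\mathcal C$ of non-empty subsets of $X$, the cover digraph $H(\mathcal C)$ has vertex set $\mathcal C$ and an arc $(A,B)$ iff $B\subsetneq A$ and no $C\in\mathcal C$ satisfies $B\subsetneq C\subsetneq A$. The digraph $N(\mathcal C)$ is obtained from $H(\mathcal C)$ by: adding,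 for each $x\in X$ with $\{x\}\notin\mathcal C$, a new vertex $\{x\}$ of outdegree 0, and an arc from each vertex $A$ of $H(\mathcal C)$ to $\{x\}$ whenever $x\in A$ and no child of $A$ in $H(\mathcal C)$ contains $x$; then adding a new child to every vertex of outdegree 0 and indegree at least 2; then identifying each leaf $l$ with the unique $x\in X$ such that $l=\{x\}$ or $l$ is the child of $\{x\}$ (vertices of $N(\mathcal C)$ other than leaves are thus subsets of $X$). For an edge clique cover $K$, $\mathcal C(K)=\{\bigcap_{Y\in S}Y : \emptyset\ne S\subseteq K,\ \bigcap_{Y\in S}Y\ne\emptyset\}$ and $N(K)=N(\mathcal C(K))$. *)

theory Defs
  imports "Graph_Theory.Graph_Theory"
begin

text \<open>
  Undirected graphs are finite, symmetric, loop-free digraphs (locale \<^locale>\<open>pair_graph\<close>): an edge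
  between \<open>x\<close> and \<open>y\<close> is the pair of arcs \<open>(x, y)\<close>, \<open>(y, x)\<close>.
\<close>

definition clique :: "'a pair_pre_digraph \<Rightarrow> 'a set \<Rightarrow> bool" where
  "clique G Y \<longleftrightarrow> Y \<subseteq> pverts G \<and> card Y \<ge> 2 \<and>
     (\<forall>x\<in>Y. \<forall>y\<in>Y. x \<noteq> y \<longrightarrow> (x, y) \<in> parcs G)"

definition edge_clique_cover :: "'a pair_pre_digraph \<Rightarrow> 'a set set \<Rightarrow> bool" where
  "edge_clique_cover G K \<longleftrightarrow> (\<forall>Y\<in>K. clique G Y) \<and>
     (\<forall>(x, y)\<in>parcs G. \<exists>Y\<in>K. x \<in> Y \<and> y \<in> Y)"

definition ecc :: "'a pair_pre_digraph \<Rightarrow> nat" where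
  "ecc G = (LEAST n. \<exists>K. edge_clique_cover G K \<and> card K = n)"

definition leaves :: "'v pair_pre_digraph \<Rightarrow> 'v set" where
  "leaves N = {v \<in> pverts N. in_degree N v = 1 \<and> out_degree N v = 0}"

definition roots :: "'v pair_pre_digraph \<Rightarrow> 'v set" where
  "roots N = {v \<in> pverts N. in_degree N v = 0}"

text \<open>
  A network on \<open>X :: 'a set\<close> has vertices in \<open>'v + 'a\<close>: the leaf \<open>x \<in> X\<close> is \<open>Inr x\<close>, and \<open>'v\<close> is an
  arbitrary type providing the remaining vertices. Multiple arcs are excluded by the arc type of
  \<^type>\<open>pair_pre_digraph\<close>, and \<^const>\<open>Digraph_Component.connected\<close> refers to the
  symmetric closure, i.e. to the underlying undirected graph.
\<close>

definition network_on :: "'a set \<Rightarrow> ('v + 'a) pair_pre_digraph \<Rightarrow> bool" where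
  "network_on X N \<longleftrightarrow>
     pair_digraph N \<and> acyclic (parcs N) \<and> Digraph_Component.connected N \<and>
     leaves N = Inr ` X \<and>
     (\<forall>v\<in>pverts N. in_degree N v = 0 \<longrightarrow> out_degree N v \<ge> 2) \<and>
     (\<forall>v\<in>pverts N. out_degree N v = 0 \<longrightarrow> in_degree N v = 1) \<and>
     (\<forall>v\<in>pverts N. \<not> (in_degree N v = 1 \<and> out_degree N v = 1))"

definition share_ancestor :: "'v pair_pre_digraph \<Rightarrow> 'v \<Rightarrow> 'v \<Rightarrow> bool" where
  "share_ancestor N x y \<longleftrightarrow>
     (\<exists>v\<in>pverts N. v \<rightarrow>\<^sup>*\<^bsub>with_proj N\<^esub> x \<and> v \<rightarrow>\<^sup>*\<^bsub>with_proj N\<^esub> y)"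

definition ancestry_graph :: "('v + 'a) pair_pre_digraph \<Rightarrow> 'a pair_pre_digraph" where
  "ancestry_graph N =
     \<lparr> pverts = {x. Inr x \<in> leaves N},
       parcs = {(x, y). Inr x \<in> leaves N \<and> Inr y \<in> leaves N \<and> x \<noteq> y \<and>
                  share_ancestor N (Inr x) (Inr y)} \<rparr>"

definition represents :: "('v + 'a) pair_pre_digraph \<Rightarrow> 'a pair_pre_digraph \<Rightarrow> bool" where
  "represents N G \<longleftrightarrow> ancestry_graph N = G"

definition cover_digraph :: "'a set set \<Rightarrow> 'a set pair_pre_digraph" where
  "cover_digraph C =
     \<lparr> pverts = C,
       parcs = {(A, B). A \<in> C \<and> B \<in> C \<and> B \<subset> A \<and> \<not> (\<exists>D\<in>C. B \<subset> D \<and> D \<subset> A)} \<rparr>"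

definition add_singletons :: "'a set \<Rightarrow> 'a set set \<Rightarrow> 'a set pair_pre_digraph" where
  "add_singletons X C =
     \<lparr> pverts = C \<union> {{x} | x. x \<in> X \<and> {x} \<notin> C},
       parcs = parcs (cover_digraph C) \<union>
         {(A, {x}) | A x. A \<in> C \<and> x \<in> X \<and> {x} \<notin> C \<and> x \<in> A \<and>
            (\<forall>B. (A, B) \<in> parcs (cover_digraph C) \<longrightarrow> x \<notin> B)} \<rparr>"

text \<open>The old vertex \<open>A\<close> becomes \<open>Inl A\<close>; its new child, if there is one, is \<open>Inr A\<close>.\<close>

definition add_children :: "'v pair_pre_digraph \<Rightarrow> ('v + 'v) pair_pre_digraph" where
  "add_children D =
     (let T = {v \<in> pverts D. out_degree D v = 0 \<and> in_degree D v \<ge> 2} in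
      \<lparr> pverts = Inl ` pverts D \<union> Inr ` T,
        parcs = map_prod Inl Inl ` parcs D \<union> (\<lambda>v. (Inl v, Inr v)) ` T \<rparr>)"

text \<open>
  The identification of leaves with elements of \<open>X\<close>: a leaf \<open>{x}\<close>, or the new child of \<open>{x}\<close>
  (which is always a leaf), becomes \<open>Inr x\<close>; every other vertex \<open>A\<close> stays the set \<open>A\<close>.
\<close>

definition leaf_label :: "('a set + 'a set) pair_pre_digraph \<Rightarrow> 'a set + 'a set \<Rightarrow> 'a set + 'a" where
  "leaf_label D v =
     (case v of
        Inl A \<Rightarrow> if v \<in> leaves D then Inr (the_elem A) else Inl A
      | Inr A \<Rightarrow> Inr (the_elem A))"

definition set_network :: "'a set \<Rightarrow> 'a set set \<Rightarrow> ('a set + 'a) pair_pre_digraph" where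
  "set_network X C =
     (let D = add_children (add_singletons X C) in
      \<lparr> pverts = leaf_label D ` pverts D,
        parcs = map_prod (leaf_label D) (leaf_label D) ` parcs D \<rparr>)"

definition intersections :: "'a set set \<Rightarrow> 'a set set" where
  "intersections K = {\<Inter>S | S. S \<noteq> {} \<and> S \<subseteq> K \<and> \<Inter>S \<noteq> {}}"

definition cover_network :: "'a set \<Rightarrow> 'a set set \<Rightarrow> ('a set + 'a) pair_pre_digraph" where
  "cover_network X K = set_network X (intersections K)"

end

theory Submission
  imports Defs
begin

text \<open>
  The family \<open>C\<close> of non-empty intersections of \<open>K\<close> has a least member \<open>core x\<close> containing a given
  \<open>x\<close>. Hence \<open>N(K)\<close> is the cover digraph of \<open>C\<close> with exactly one additional arc, from \<open>core x\<close> to the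
  leaf \<open>x\<close>, for each \<open>x\<close>; the leaves below \<open>A \<in> C\<close> are the elements of \<open>A\<close>, and the roots are the
  inclusion-maximal members of \<open>K\<close>. Conversely, the leaf sets below the roots of any network
  representing \<open>G\<close> form an edge clique cover of \<open>G\<close>, so no such network has fewer than \<open>ecc G\<close> roots.
\<close>

lemma in_degree_eq_card: "in_degree (with_proj N) v = card {u. (u, v) \<in> parcs N}"
proof -
  have "in_arcs (with_proj N) v = (\<lambda>u. (u, v)) ` {u. (u, v) \<in> parcs N}"
    by (auto simp: in_arcs_def)
  then show ?thesis by (simp add: in_degree_def card_image inj_on_def)
qed

lemma out_degree_eq_card: "out_degree (with_proj N) v = card {w. (v, w) \<in> parcs N}"
proof -
  have "out_arcs (with_proj N) v = (\<lambda>w. (v, w)) ` {w. (v, w) \<in> parcs N}"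
    by (auto simp: out_arcs_def)
  then show ?thesis by (simp add: out_degree_def card_image inj_on_def)
qed

lemma card_ge_2I: "finite S \<Longrightarrow> a \<in> S \<Longrightarrow> b \<in> S \<Longrightarrow> a \<noteq> b \<Longrightarrow> card S \<ge> 2"
  using card_mono[of S "{a, b}"] by simp

lemma cover_digraph_arcI:
  "A \<in> C \<Longrightarrow> B \<in> C \<Longrightarrow> B \<subset> A \<Longrightarrow> (\<And>E. E \<in> C \<Longrightarrow> B \<subset> E \<Longrightarrow> \<not> E \<subset> A)
    \<Longrightarrow> (A, B) \<in> parcs (cover_digraph C)"
  by (auto simp: cover_digraph_def)

lemma cover_digraph_child_between:
  assumes "finite C" "A \<in> C" "B \<in> C" "B \<subset> A"
  shows "\<exists>D. (A, D) \<in> parcs (cover_digraph C) \<and> B \<subseteq> D"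
proof -
  let ?S = "{D \<in> C. B \<subseteq> D \<and> D \<subset> A}"
  have "finite ?S" "B \<in> ?S" using assms by auto
  from finite_has_maximal2[OF this]
  obtain D where D: "D \<in> ?S" "\<forall>E\<in>?S. D \<subseteq> E \<longrightarrow> D = E"
    by (elim bexE conjE) (rule that)
  have "(A, D) \<in> parcs (cover_digraph C)"
  proof (rule cover_digraph_arcI)
    show "A \<in> C" "D \<in> C" "D \<subset> A" using assms(2) D(1) by simp_all
    show "\<not> E \<subset> A" if "E \<in> C" "D \<subset> E" for E
    proof
      assume "E \<subset> A"
      then have "E \<in> ?S" using that D(1) by (auto simp: psubset_eq)
      then show False using D(2)[rule_format, of E] that(2) by (simp add: psubset_eq)
    qed
  qed
  with D(1) show ?thesis by blast
qed

lemma cover_digraph_parent_between: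
  assumes "finite C" "A \<in> C" "B \<in> C" "B \<subset> A"
  shows "\<exists>D. (D, B) \<in> parcs (cover_digraph C) \<and> D \<subseteq> A"
proof -
  let ?S = "{D \<in> C. B \<subset> D \<and> D \<subseteq> A}"
  have "finite ?S" "A \<in> ?S" using assms by auto
  from finite_has_minimal2[OF this]
  obtain D where D: "D \<in> ?S" "\<forall>E\<in>?S. E \<subseteq> D \<longrightarrow> D = E"
    by (elim bexE conjE) (rule that)
  have "(D, B) \<in> parcs (cover_digraph C)"
  proof (rule cover_digraph_arcI)
    show "D \<in> C" "B \<in> C" "B \<subset> D" using assms(3) D(1) by simp_all
    show "\<not> E \<subset> D" if "E \<in> C" "B \<subset> E" for E
    proof
      assume "E \<subset> D"
      then have "E \<in> ?S" using that D(1) by (auto simp: psubset_eq)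
      then show False using D(2)[rule_format, of E] \<open>E \<subset> D\<close> by (simp add: psubset_eq)
    qed
  qed
  with D(1) show ?thesis by blast
qed

locale covering_family =
  fixes X :: "'a set" and K :: "'a set set"
  assumes finite_ground: "finite X"
    and Union_eq: "\<Union>K = X"
    and card_member: "Y \<in> K \<Longrightarrow> card Y \<ge> 2"
begin

abbreviation C where "C \<equiv> intersections K"
abbreviation cov where "cov \<equiv> parcs (cover_digraph C)"

definition core :: "'a \<Rightarrow> 'a set" where
  "core x = \<Inter>{Y \<in> K. x \<in> Y}"

lemma member_C_subset: "A \<in> C \<Longrightarrow> A \<subseteq> X"
  using Union_eq unfolding intersections_def by blast

lemma member_C_nonempty: "A \<in> C \<Longrightarrow> A \<noteq> {}"
  unfolding intersections_def by blast

lemma finite_C: "finite C"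
  using member_C_subset finite_ground by (meson Pow_iff finite_Pow_iff finite_subset subsetI)

lemma finite_member_C: "A \<in> C \<Longrightarrow> finite A"
  using member_C_subset finite_ground finite_subset by blast

lemma K_subset_C: "K \<subseteq> C"
proof
  fix Y assume Y: "Y \<in> K"
  then have "Y \<noteq> {}" using card_member by fastforce
  with Y show "Y \<in> C" unfolding intersections_def
    by (auto intro!: exI[of _ "{Y}"])
qed

lemma mem_core: "x \<in> core x"
  unfolding core_def by blast

lemma core_in_C: "x \<in> X \<Longrightarrow> core x \<in> C"
  using mem_core[of x] Union_eq unfolding core_def intersections_def by blast

lemma core_least: "A \<in> C \<Longrightarrow> x \<in> A \<Longrightarrow> core x \<subseteq> A"
  unfolding core_def intersections_def by blast

lemma core_singleton: "{x} \<in> C \<Longrightarrow> core x = {x}"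
  using core_least[of "{x}" x] mem_core[of x] by blast

lemma covD: "(A, B) \<in> cov \<Longrightarrow> A \<in> C \<and> B \<in> C \<and> B \<subset> A"
  unfolding cover_digraph_def by auto

lemma cov_child_containing:
  assumes "A \<in> C" "x \<in> A" "A \<noteq> core x"
  shows "\<exists>B. (A, B) \<in> cov \<and> x \<in> B"
proof -
  have "core x \<subset> A" using assms core_least by blast
  moreover have "core x \<in> C" using assms member_C_subset core_in_C by blast
  ultimately show ?thesis
    using cover_digraph_child_between[OF finite_C, of A "core x"] assms(1) mem_core by blast
qed

lemma no_child_containing_iff:
  assumes "A \<in> C" "x \<in> A"
  shows "(\<forall>B. (A, B) \<in> cov \<longrightarrow> x \<notin> B) \<longleftrightarrow> A = core x"
proof
  assume "\<forall>B. (A, B) \<in> cov \<longrightarrow> x \<notin> B"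
  then show "A = core x" using cov_child_containing[OF assms] by blast
next
  assume A: "A = core x"
  show "\<forall>B. (A, B) \<in> cov \<longrightarrow> x \<notin> B"
  proof (intro allI impI notI)
    fix B assume "(A, B) \<in> cov" "x \<in> B"
    then show False using covD[of A B] core_least[of B x] A by auto
  qed
qed

text \<open>A unique parent of \<open>{x}\<close> would lie in every member of \<open>K\<close> containing \<open>x\<close>, hence in \<open>{x}\<close>.\<close>

lemma two_parents_of_singleton:
  assumes "{x} \<in> C"
  shows "card {A. (A, {x}) \<in> cov} \<ge> 2"
proof -
  have x: "x \<in> X" using assms member_C_subset by blast
  have above: "\<exists>D. (D, {x}) \<in> cov \<and> D \<subseteq> Y" if "Y \<in> K" "x \<in> Y" for Y
  proof -
    have "Y \<noteq> {x}" using card_member[OF that(1)] by auto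
    then show ?thesis
      using cover_digraph_parent_between[OF finite_C _ assms, of Y] that K_subset_C by blast
  qed
  obtain Y where Y: "Y \<in> K" "x \<in> Y" using x Union_eq by blast
  obtain P where P: "(P, {x}) \<in> cov" using above[OF Y] by blast
  then have "{x} \<subset> P" using covD by blast
  moreover have "core x = {x}" using assms core_singleton by blast
  ultimately obtain Z where Z: "Z \<in> K" "x \<in> Z" "\<not> P \<subseteq> Z"
    unfolding core_def by blast
  obtain Q where Q: "(Q, {x}) \<in> cov" "Q \<subseteq> Z" using above[OF Z(1,2)] by blast
  have "finite {A. (A, {x}) \<in> cov}"
    by (rule finite_subset[OF _ finite_C]) (use covD in blast)
  then show ?thesis using card_ge_2I[of _ P Q] P Q Z by auto
qed

abbreviation H where "H \<equiv> add_singletons X C"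

lemma pverts_H: "pverts H = C \<union> {{x} | x. x \<in> X \<and> {x} \<notin> C}"
  by (simp add: add_singletons_def)

lemma parcs_H: "parcs H = cov \<union> {(core x, {x}) | x. x \<in> X \<and> {x} \<notin> C}"
proof -
  have "{(A, {x}) | A x. A \<in> C \<and> x \<in> X \<and> {x} \<notin> C \<and> x \<in> A \<and>
            (\<forall>B. (A, B) \<in> cov \<longrightarrow> x \<notin> B)} = {(core x, {x}) | x. x \<in> X \<and> {x} \<notin> C}"
    using no_child_containing_iff core_in_C mem_core by blast
  then show ?thesis by (simp add: add_singletons_def)
qed

lemma parcs_H_singleton: "(A, {x}) \<in> parcs H \<Longrightarrow> {x} \<notin> C \<Longrightarrow> A = core x"
  using covD by (auto simp: parcs_H)

lemma H_child:
  assumes "A \<in> C" "A \<noteq> {x}" "x \<in> A"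
  shows "\<exists>B. (A, B) \<in> parcs H"
proof (cases "A = core x")
  case True
  then have "{x} \<notin> C" using assms core_singleton by auto
  then show ?thesis using True assms member_C_subset by (auto simp: parcs_H)
next
  case False
  then show ?thesis using cov_child_containing[OF assms(1,3)] by (auto simp: parcs_H)
qed

lemma finite_parcs_H: "finite (parcs H)"
proof -
  have "cov \<subseteq> C \<times> C" using covD by auto
  then have "finite cov" using finite_C finite_subset by blast
  moreover have "{(core x, {x}) | x. x \<in> X \<and> {x} \<notin> C} \<subseteq> (\<lambda>x. (core x, {x})) ` X" by auto
  then have "finite {(core x, {x}) | x. x \<in> X \<and> {x} \<notin> C}"
    using finite_ground finite_subset by blast
  ultimately show ?thesis by (simp add: parcs_H)
qed

lemma finite_H_children: "finite {B. (A, B) \<in> parcs H}"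
  by (rule finite_subset[of _ "snd ` parcs H"]) (use finite_parcs_H in force)+

lemma no_H_child_singleton: "{B. ({x}, B) \<in> parcs H} = {}"
proof -
  have "({x}, B) \<notin> cov" for B
    using covD[of "{x}" B] member_C_nonempty[of B] by auto
  moreover have "core y \<noteq> {x} \<or> {y} \<in> C" if "y \<in> X" for y
    using that mem_core[of y] core_in_C[of y] by auto
  ultimately show ?thesis by (auto simp: parcs_H)
qed

lemma extended_vertices_H:
  "{v \<in> pverts H. out_degree (with_proj H) v = 0 \<and> in_degree (with_proj H) v \<ge> 2} =
     {{x} | x. {x} \<in> C}"
proof (intro set_eqI iffI)
  fix v assume v: "v \<in> {v \<in> pverts H. out_degree (with_proj H) v = 0 \<and> in_degree (with_proj H) v \<ge> 2}"
  then have nochild: "{B. (v, B) \<in> parcs H} = {}"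
    using finite_H_children[of v] by (simp add: out_degree_eq_card)
  have "v \<in> C"
  proof (rule ccontr)
    assume "v \<notin> C"
    then obtain x where x: "v = {x}" "{x} \<notin> C" using v pverts_H by blast
    then have "{u. (u, v) \<in> parcs H} \<subseteq> {core x}" using parcs_H_singleton by auto
    then have "card {u. (u, v) \<in> parcs H} \<le> 1"
      using card_mono[of "{core x}"] by simp
    then show False using v by (simp add: in_degree_eq_card)
  qed
  moreover obtain x where "x \<in> v" using member_C_nonempty calculation by blast
  ultimately have "v = {x}" using H_child nochild by blast
  then show "v \<in> {{x} | x. {x} \<in> C}" using \<open>v \<in> C\<close> by blast
next
  fix v assume "v \<in> {{x} | x. {x} \<in> C}"
  then obtain x where x: "v = {x}" "{x} \<in> C" by blast
  have "{A. (A, {x}) \<in> parcs H} = {A. (A, {x}) \<in> cov}" using x by (auto simp: parcs_H)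
  then have "in_degree (with_proj H) v \<ge> 2"
    using two_parents_of_singleton[OF x(2)] x(1) by (simp add: in_degree_eq_card)
  moreover have "out_degree (with_proj H) v = 0"
    using no_H_child_singleton x(1) by (simp add: out_degree_eq_card)
  ultimately show "v \<in> {v \<in> pverts H. out_degree (with_proj H) v = 0 \<and> in_degree (with_proj H) v \<ge> 2}"
    using x by (simp add: pverts_H)
qed

abbreviation D where "D \<equiv> add_children H"

lemma pverts_D: "pverts D = Inl ` pverts H \<union> Inr ` {{x} | x. {x} \<in> C}"
  and parcs_D: "parcs D = map_prod Inl Inl ` parcs H \<union> (\<lambda>v. (Inl v, Inr v)) ` {{x} | x. {x} \<in> C}"
  by (simp_all only: add_children_def Let_def extended_vertices_H pair_pre_digraph.select_convs)

lemma finite_parcs_D: "finite (parcs D)"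
proof -
  have "{{x} | x. {x} \<in> C} \<subseteq> C" by auto
  then have "finite {{x} | x. {x} \<in> C}" using finite_C finite_subset by blast
  then show ?thesis using finite_parcs_H by (simp add: parcs_D)
qed

lemma Inl_in_leaves_D_iff:
  assumes "A \<in> pverts H"
  shows "Inl A \<in> leaves D \<longleftrightarrow> A \<notin> C"
proof
  assume leaf: "Inl A \<in> leaves D"
  have "finite {w. (Inl A, w) \<in> parcs D}"
    by (rule finite_subset[of _ "snd ` parcs D"]) (use finite_parcs_D in force)+
  then have no: "(Inl A, w) \<notin> parcs D" for w
    using leaf by (auto simp: leaves_def out_degree_eq_card)
  show "A \<notin> C"
  proof
    assume A: "A \<in> C"
    then obtain x where x: "x \<in> A" using member_C_nonempty by blast
    show False
    proof (cases "A = {x}")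
      case True
      then have "(Inl A, Inr A) \<in> parcs D" using A by (auto simp: parcs_D)
      then show False using no by blast
    next
      case False
      then obtain B where "(A, B) \<in> parcs H" using H_child A x by blast
      then have "(Inl A, Inl B) \<in> parcs D" by (force simp: parcs_D)
      then show False using no by blast
    qed
  qed
next
  assume A: "A \<notin> C"
  then obtain x where x: "A = {x}" "x \<in> X" "{x} \<notin> C" using assms pverts_H by blast
  have "{w. (Inl A, w) \<in> parcs D} = {}"
    using no_H_child_singleton[of x] x by (auto simp: parcs_D)
  then have "out_degree (with_proj D) (Inl A) = 0"
    by (simp add: out_degree_eq_card)
  have "(core x, {x}) \<in> parcs H" using x by (auto simp: parcs_H)
  moreover have "(u, Inl A) \<in> parcs D \<longleftrightarrow> (\<exists>B. u = Inl B \<and> (B, {x}) \<in> parcs H)" for u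
    using x(1) by (auto simp: parcs_D)
  ultimately have "{u. (u, Inl A) \<in> parcs D} = {Inl (core x)}"
    using parcs_H_singleton[of _ x] x(3) by blast
  then have "in_degree (with_proj D) (Inl A) = 1"
    by (simp add: in_degree_eq_card)
  then show "Inl A \<in> leaves D"
    using assms \<open>out_degree (with_proj D) (Inl A) = 0\<close> by (simp add: leaves_def pverts_D)
qed

lemma leaf_label_C: "A \<in> C \<Longrightarrow> leaf_label D (Inl A) = Inl A"
  using Inl_in_leaves_D_iff[of A] by (simp add: leaf_label_def pverts_H)

lemma leaf_label_singleton: "x \<in> X \<Longrightarrow> {x} \<notin> C \<Longrightarrow> leaf_label D (Inl {x}) = Inr x"
  using Inl_in_leaves_D_iff[of "{x}"] by (simp add: leaf_label_def pverts_H)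

lemma leaf_label_Inr: "leaf_label D (Inr {x}) = Inr x"
  by (simp add: leaf_label_def)

abbreviation N where "N \<equiv> cover_network X K"

lemma pverts_N: "pverts N = Inl ` C \<union> Inr ` X"
proof -
  have "pverts D = Inl ` C \<union> (\<lambda>x. Inl {x}) ` {x \<in> X. {x} \<notin> C} \<union> (\<lambda>x. Inr {x}) ` {x. {x} \<in> C}"
    unfolding pverts_D pverts_H by blast
  moreover have "{x. {x} \<in> C} \<subseteq> X" using member_C_subset by blast
  ultimately have "leaf_label D ` pverts D =
      Inl ` C \<union> Inr ` {x \<in> X. {x} \<notin> C} \<union> Inr ` {x. {x} \<in> C}"
    by (simp add: image_Un image_image leaf_label_C leaf_label_singleton leaf_label_Inr cong: image_cong_simp)
  also have "\<dots> = Inl ` C \<union> Inr ` X" using \<open>{x. {x} \<in> C} \<subseteq> X\<close> by blast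
  finally show ?thesis
    by (simp add: cover_network_def set_network_def Let_def)
qed

lemma parcs_N: "parcs N = map_prod Inl Inl ` cov \<union> (\<lambda>x. (Inl (core x), Inr x)) ` X"
proof -
  let ?f = "map_prod (leaf_label D) (leaf_label D)"
  have D: "parcs D = map_prod Inl Inl ` cov \<union> (\<lambda>x. (Inl (core x), Inl {x})) ` {x \<in> X. {x} \<notin> C}
      \<union> (\<lambda>x. (Inl (core x), Inr {x})) ` {x. {x} \<in> C}"
    unfolding parcs_D parcs_H by (auto simp: core_singleton image_iff)
  have sub: "{x. {x} \<in> C} \<subseteq> X" using member_C_subset by blast
  have "?f ` map_prod Inl Inl ` cov = map_prod Inl Inl ` cov"
    unfolding image_image
    by (rule image_cong) (use covD leaf_label_C in auto)
  moreover have "?f ` (\<lambda>x. (Inl (core x), Inl {x})) ` {x \<in> X. {x} \<notin> C} =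
      (\<lambda>x. (Inl (core x), Inr x)) ` {x \<in> X. {x} \<notin> C}"
    unfolding image_image
    by (rule image_cong) (auto simp: leaf_label_C core_in_C leaf_label_singleton)
  moreover have "?f ` (\<lambda>x. (Inl (core x), Inr {x})) ` {x. {x} \<in> C} =
      (\<lambda>x. (Inl (core x), Inr x)) ` {x. {x} \<in> C}"
    unfolding image_image
    by (rule image_cong) (use sub in \<open>auto simp: leaf_label_C core_in_C leaf_label_Inr\<close>)
  ultimately have "?f ` parcs D = map_prod Inl Inl ` cov \<union>
      (\<lambda>x. (Inl (core x), Inr x)) ` {x \<in> X. {x} \<notin> C} \<union>
      (\<lambda>x. (Inl (core x), Inr x)) ` {x. {x} \<in> C}"
    unfolding D image_Un by simp
  also have "\<dots> = map_prod Inl Inl ` cov \<union> (\<lambda>x. (Inl (core x), Inr x)) ` X"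
    using sub by blast
  finally show ?thesis
    by (simp add: cover_network_def set_network_def Let_def)
qed

lemma parcs_N_Inl: "(Inl A, Inl B) \<in> parcs N \<longleftrightarrow> (A, B) \<in> cov"
  and parcs_N_leaf: "(Inl A, Inr x) \<in> parcs N \<longleftrightarrow> x \<in> X \<and> A = core x"
  and parcs_N_from_leaf: "(Inr y, v) \<notin> parcs N"
  by (auto simp: parcs_N)

lemma finite_pverts_N: "finite (pverts N)"
  using finite_C finite_ground by (simp add: pverts_N)

lemma pair_digraph_N: "pair_digraph N"
proof
  fix e assume "e \<in> parcs N"
  then show "fst e \<in> pverts N" "snd e \<in> pverts N" "fst e \<noteq> snd e"
    using covD core_in_C by (fastforce simp: parcs_N pverts_N)+
next
  show "finite (pverts N)" by (rule finite_pverts_N)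
  have "parcs N \<subseteq> pverts N \<times> pverts N"
    using covD core_in_C by (auto simp: parcs_N pverts_N)
  then show "finite (parcs N)" using finite_pverts_N finite_subset by blast
qed

sublocale N: pair_digraph N by (rule pair_digraph_N)

lemma finite_children_N: "finite {w. (v, w) \<in> parcs N}"
  and finite_parents_N: "finite {u. (u, v) \<in> parcs N}"
  using finite_pverts_N N.in_arcsD1 N.in_arcsD2
  by (auto intro: finite_subset[of _ "pverts N"])

lemma acyclic_N: "acyclic (parcs N)"
proof -
  define rank where "rank v = (case v of Inl A \<Rightarrow> card A | Inr x \<Rightarrow> 0)" for v :: "'a set + 'a"
  have "parcs N \<subseteq> (measure rank)\<inverse>"
  proof
    fix e assume "e \<in> parcs N"
    then consider A B where "e = (Inl A, Inl B)" "(A, B) \<in> cov"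
      | x where "e = (Inl (core x), Inr x)" "x \<in> X"
      by (auto simp: parcs_N)
    then show "e \<in> (measure rank)\<inverse>"
    proof cases
      case 1
      then have "B \<subset> A" "finite A" using covD finite_member_C by blast+
      then show ?thesis using 1 by (simp add: rank_def psubset_card_mono)
    next
      case 2
      then have "card (core x) > 0" using core_in_C finite_member_C mem_core card_gt_0_iff by blast
      then show ?thesis using 2 by (simp add: rank_def)
    qed
  qed
  moreover have "acyclic ((measure rank)\<inverse>)"
    by (simp add: wf_acyclic)
  ultimately show ?thesis using acyclic_subset by blast
qed

lemma reachable_leaf:
  assumes "A \<in> C" "x \<in> A"
  shows "Inl A \<rightarrow>\<^sup>*\<^bsub>with_proj N\<^esub> Inr x"
  using assms
proof (induction "card A" arbitrary: A rule: less_induct)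
  case less
  show ?case
  proof (cases "A = core x")
    case True
    then have "(Inl A, Inr x) \<in> parcs N"
      using less.prems member_C_subset parcs_N_leaf by blast
    then show ?thesis by (simp add: N.reachable_adjI)
  next
    case False
    then obtain B where B: "(A, B) \<in> cov" "x \<in> B"
      using cov_child_containing less.prems by blast
    then have "card B < card A" "B \<in> C"
      using covD[of A B] finite_member_C[of A] by (simp_all add: psubset_card_mono)
    then have "Inl B \<rightarrow>\<^sup>*\<^bsub>with_proj N\<^esub> Inr x" using less.hyps B by blast
    moreover have "(Inl A, Inl B) \<in> parcs N" using B parcs_N_Inl by blast
    ultimately show ?thesis by (simp add: N.adj_reachable_trans)
  qed
qed

lemma reachable_leafD:
  assumes "v \<rightarrow>\<^sup>*\<^bsub>with_proj N\<^esub> Inr x"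
  shows "v = Inr x \<or> (\<exists>A. v = Inl A \<and> A \<in> C \<and> x \<in> A)"
  using assms
proof (induction rule: N.converse_reachable_induct)
  case base
  then show ?case by simp
next
  case (step u w)
  then have uw: "(u, w) \<in> parcs N" by simp
  then obtain A where A: "u = Inl A" using parcs_N_from_leaf by (cases u) auto
  from step.IH show ?case
  proof
    assume "w = Inr x"
    then show ?thesis using uw A parcs_N_leaf core_in_C mem_core by blast
  next
    assume "\<exists>B. w = Inl B \<and> B \<in> C \<and> x \<in> B"
    then show ?thesis using uw A parcs_N_Inl covD by blast
  qed
qed

lemma share_ancestor_N_iff:
  assumes "x \<noteq> y"
  shows "share_ancestor N (Inr x) (Inr y) \<longleftrightarrow> (\<exists>Y\<in>K. x \<in> Y \<and> y \<in> Y)"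
proof
  assume "share_ancestor N (Inr x) (Inr y)"
  then obtain v where v: "v \<rightarrow>\<^sup>*\<^bsub>with_proj N\<^esub> Inr x" "v \<rightarrow>\<^sup>*\<^bsub>with_proj N\<^esub> Inr y"
    unfolding share_ancestor_def by blast
  then obtain A where "A \<in> C" "x \<in> A" "y \<in> A"
    using reachable_leafD[OF v(1)] reachable_leafD[OF v(2)] assms by auto
  then show "\<exists>Y\<in>K. x \<in> Y \<and> y \<in> Y" unfolding intersections_def by blast
next
  assume "\<exists>Y\<in>K. x \<in> Y \<and> y \<in> Y"
  then obtain Y where "Y \<in> C" "x \<in> Y" "y \<in> Y" using K_subset_C by blast
  then show "share_ancestor N (Inr x) (Inr y)"
    unfolding share_ancestor_def using reachable_leaf pverts_N by blast
qed

lemma out_degree_leaf: "out_degree (with_proj N) (Inr x) = 0"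
  by (simp add: out_degree_eq_card parcs_N_from_leaf)

lemma in_degree_leaf:
  assumes "x \<in> X" shows "in_degree (with_proj N) (Inr x) = 1"
proof -
  have "{u. (u, Inr x) \<in> parcs N} = {Inl (core x)}"
    using assms by (auto simp: parcs_N)
  then show ?thesis by (simp add: in_degree_eq_card)
qed

text \<open>The children of \<open>A\<close> cover \<open>A\<close>, and each of them is a proper subset.\<close>

lemma out_degree_ge_2:
  assumes "A \<in> C" "card A \<ge> 2"
  shows "out_degree (with_proj N) (Inl A) \<ge> 2"
proof -
  define S where "S = (\<lambda>v :: 'a set + 'a. case v of Inl B \<Rightarrow> B | Inr x \<Rightarrow> {x})"
  have child: "\<exists>w. (Inl A, w) \<in> parcs N \<and> x \<in> S w" if x: "x \<in> A" for x
  proof (cases "A = core x")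
    case True
    then have "(Inl A, Inr x) \<in> parcs N"
      using x assms member_C_subset parcs_N_leaf by blast
    then show ?thesis by (auto simp: S_def)
  next
    case False
    then obtain B where "(A, B) \<in> cov" "x \<in> B" using x assms cov_child_containing by blast
    then show ?thesis using parcs_N_Inl by (intro exI[of _ "Inl B"]) (simp add: S_def)
  qed
  obtain x where x: "x \<in> A" using assms member_C_nonempty by blast
  obtain v where v: "(Inl A, v) \<in> parcs N" "x \<in> S v" using child x by blast
  have "\<exists>y\<in>A. y \<notin> S v"
  proof (cases v)
    case (Inl B)
    then show ?thesis using v covD[of A B] parcs_N_Inl by (auto simp: S_def)
  next
    case (Inr z)
    have "\<not> A \<subseteq> {z}" using assms(2) card_mono[of "{z}" A] by auto
    then show ?thesis using Inr by (auto simp: S_def)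
  qed
  then obtain y where y: "y \<in> A" "y \<notin> S v" by blast
  obtain w where w: "(Inl A, w) \<in> parcs N" "y \<in> S w" using child y by blast
  have "v \<noteq> w" using y w by blast
  then show ?thesis
    using card_ge_2I[OF finite_children_N, of v "Inl A" w] v w by (simp add: out_degree_eq_card)
qed

lemma singleton_or_card_ge_2: "A \<in> C \<Longrightarrow> card A \<ge> 2 \<or> (\<exists>x. A = {x})"
  using finite_member_C member_C_nonempty card_1_singletonE
  by (metis One_nat_def Suc_1 card_gt_0_iff le_less_linear less_2_cases_iff less_nat_zero_code not_less_eq_eq)

lemma singleton_degrees:
  assumes "{x} \<in> C"
  shows "out_degree (with_proj N) (Inl {x}) \<noteq> 0" "in_degree (with_proj N) (Inl {x}) \<ge> 2"
proof -
  have "(Inl {x}, Inr x) \<in> parcs N"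
    using assms core_singleton member_C_subset by (auto simp: parcs_N_leaf)
  then show "out_degree (with_proj N) (Inl {x}) \<noteq> 0"
    using finite_children_N[of "Inl {x}"] by (auto simp: out_degree_eq_card)
  have "{u. (u, Inl {x}) \<in> parcs N} = Inl ` {A. (A, {x}) \<in> cov}"
    by (auto simp: parcs_N)
  then show "in_degree (with_proj N) (Inl {x}) \<ge> 2"
    using two_parents_of_singleton[OF assms] by (simp add: in_degree_eq_card card_image)
qed

lemma degrees_Inl:
  assumes "A \<in> C"
  shows "out_degree (with_proj N) (Inl A) \<noteq> 0"
    and "in_degree (with_proj N) (Inl A) \<ge> 2 \<or> out_degree (with_proj N) (Inl A) \<ge> 2"
proof -
  from singleton_or_card_ge_2[OF assms]
  have "out_degree (with_proj N) (Inl A) \<noteq> 0 \<and>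
    (in_degree (with_proj N) (Inl A) \<ge> 2 \<or> out_degree (with_proj N) (Inl A) \<ge> 2)"
  proof
    assume "card A \<ge> 2"
    then show ?thesis using out_degree_ge_2[OF assms] by linarith
  next
    assume "\<exists>x. A = {x}"
    then obtain x where x: "A = {x}" by blast
    then have "{x} \<in> C" using assms by simp
    then show ?thesis using singleton_degrees[of x] x by simp
  qed
  then show "out_degree (with_proj N) (Inl A) \<noteq> 0"
    "in_degree (with_proj N) (Inl A) \<ge> 2 \<or> out_degree (with_proj N) (Inl A) \<ge> 2"
    by simp_all
qed

lemma leaves_N: "leaves N = Inr ` X"
  using out_degree_leaf in_degree_leaf degrees_Inl(1) by (fastforce simp: leaves_def pverts_N)

lemma Inl_root_iff:
  assumes "A \<in> C"
  shows "Inl A \<in> roots N \<longleftrightarrow> (\<forall>B\<in>C. \<not> A \<subset> B)"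
proof -
  have "Inl A \<in> roots N \<longleftrightarrow> (\<forall>u. (u, Inl A) \<notin> parcs N)"
    using assms finite_parents_N[of "Inl A"] by (auto simp: roots_def pverts_N in_degree_eq_card)
  also have "\<dots> \<longleftrightarrow> (\<forall>B. (B, A) \<notin> cov)"
    by (auto simp: parcs_N)
  also have "\<dots> \<longleftrightarrow> (\<forall>B\<in>C. \<not> A \<subset> B)"
  proof
    assume no: "\<forall>B. (B, A) \<notin> cov"
    show "\<forall>B\<in>C. \<not> A \<subset> B"
    proof (intro ballI notI)
      fix B assume "B \<in> C" "A \<subset> B"
      then show False
        using cover_digraph_parent_between[OF finite_C _ assms, of B] no by simp
    qed
  next
    assume "\<forall>B\<in>C. \<not> A \<subset> B"
    then show "\<forall>B. (B, A) \<notin> cov" using covD by meson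
  qed
  finally show ?thesis .
qed

lemma roots_N: "roots N = Inl ` {A \<in> K. \<forall>B\<in>K. \<not> A \<subset> B}"
proof -
  have "Inr x \<notin> roots N" for x
    using in_degree_leaf[of x] by (auto simp: roots_def pverts_N)
  moreover have "roots N \<subseteq> pverts N" by (auto simp: roots_def)
  ultimately have "roots N = Inl ` {A \<in> C. \<forall>B\<in>C. \<not> A \<subset> B}"
    using Inl_root_iff pverts_N by auto
  also have "{A \<in> C. \<forall>B\<in>C. \<not> A \<subset> B} = {A \<in> K. \<forall>B\<in>K. \<not> A \<subset> B}"
  proof -
    have above: "\<exists>Y\<in>K. A \<subseteq> Y" if "A \<in> C" for A
      using that unfolding intersections_def by blast
    show ?thesis
    proof (intro set_eqI iffI CollectI conjI ballI)
      fix A assume A: "A \<in> {A \<in> C. \<forall>B\<in>C. \<not> A \<subset> B}"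
      then obtain Y where Y: "Y \<in> K" "A \<subseteq> Y" using above[of A] by auto
      then have "A = Y" using A K_subset_C by (auto simp: psubset_eq)
      then show "A \<in> K" using Y by simp
      show "\<not> A \<subset> B" if "B \<in> K" for B using that A K_subset_C by auto
    next
      fix A assume A: "A \<in> {A \<in> K. \<forall>B\<in>K. \<not> A \<subset> B}"
      then show "A \<in> C" using K_subset_C by auto
      show "\<not> A \<subset> B" if B: "B \<in> C" for B
      proof
        assume "A \<subset> B"
        moreover obtain Y where Y: "Y \<in> K" "B \<subseteq> Y" using above[OF B] by auto
        ultimately have "A \<subset> Y" by (simp add: psubset_subset_trans)
        then show False using A Y(1) by simp
      qed
    qed
  qed
  finally show ?thesis .
qed

lemma roots_N_eq_iff: "roots N = Inl ` K \<longleftrightarrow> \<not> (\<exists>A\<in>K. \<exists>B\<in>K. A \<noteq> B \<and> A \<subseteq> B)"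
proof -
  have "roots N = Inl ` K \<longleftrightarrow> {A \<in> K. \<forall>B\<in>K. \<not> A \<subset> B} = K"
    unfolding roots_N by (rule inj_image_eq_iff) simp
  then show ?thesis by blast
qed

end

lemma connected_edge_clique_cover_Union:
  assumes "pair_graph G" "Digraph_Component.connected (with_proj G)"
    and "card (pverts G) \<ge> 2" "edge_clique_cover G K"
  shows "\<Union>K = pverts G"
proof
  show "\<Union>K \<subseteq> pverts G"
    using assms(4) unfolding edge_clique_cover_def clique_def by blast
  interpret pair_graph G by fact
  show "pverts G \<subseteq> \<Union>K"
  proof
    fix x assume x: "x \<in> pverts G"
    have "\<not> pverts G \<subseteq> {x}" using assms(3) card_mono[of "{x}" "pverts G"] by auto
    then obtain y where y: "y \<in> pverts G" "y \<noteq> x" by blast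
    have "x \<rightarrow>\<^sup>*\<^bsub>with_proj (mk_symmetric (with_proj G))\<^esub> y"
      using assms(2) x y unfolding connected_def strongly_connected_def by simp
    then have "x \<rightarrow>\<^sup>*\<^bsub>with_proj G\<^esub> y"
      using reachable_mk_symmetric_eq[OF pair_sym_arcs] by simp
    then obtain z where "(x, z) \<in> parcs G"
      using y(2) by (cases rule: converse_reachable_cases) auto
    then show "x \<in> \<Union>K" using assms(4) unfolding edge_clique_cover_def by blast
  qed
qed

text \<open>Cliques of \<open>K\<close> link adjacent leaves, so connectivity of \<open>G\<close> passes to the leaves, and every
  other vertex has a leaf below it.\<close>

lemma (in covering_family) connected_cover_network:
  assumes "pair_graph G" "Digraph_Component.connected (with_proj G)"
    and "pverts G = X" "edge_clique_cover G K"
  shows "Digraph_Component.connected (with_proj N)"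
proof -
  interpret G: pair_graph G by fact
  let ?S = "mk_symmetric (with_proj N)"
  interpret S: pair_wf_digraph ?S by (rule N.wellformed_mk_symmetric)
  have sym: "v \<rightarrow>\<^sup>*\<^bsub>with_proj ?S\<^esub> u" if "u \<rightarrow>\<^sup>*\<^bsub>with_proj ?S\<^esub> v" for u v
    using symmetric_reachable[OF symmetric_mk_symmetric that] .
  have down: "Inl A \<rightarrow>\<^sup>*\<^bsub>with_proj ?S\<^esub> Inr x" if "A \<in> C" "x \<in> A" for A x
    using N.reachable_mk_symmetricI[OF reachable_leaf[OF that]] .
  have leaf: "Inr x \<rightarrow>\<^sup>*\<^bsub>with_proj ?S\<^esub> Inr y" if "x \<rightarrow>\<^sup>*\<^bsub>with_proj G\<^esub> y" for x y
    using that
  proof (induction rule: G.converse_reachable_induct)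
    case base
    then show ?case using assms(3) pverts_N by simp
  next
    case (step x z)
    then have "(x, z) \<in> parcs G" by simp
    then obtain Y where "Y \<in> K" "x \<in> Y" "z \<in> Y"
      using assms(4) unfolding edge_clique_cover_def by blast
    then have "Inr x \<rightarrow>\<^sup>*\<^bsub>with_proj ?S\<^esub> Inr z"
      using down sym K_subset_C S.reachable_trans by blast
    then show ?case using step S.reachable_trans by blast
  qed
  have leaves: "Inr x \<rightarrow>\<^sup>*\<^bsub>with_proj ?S\<^esub> Inr y" if "x \<in> X" "y \<in> X" for x y
    using leaf assms(2) that G.reachable_mk_symmetric_eq[OF G.pair_sym_arcs]
    unfolding connected_def strongly_connected_def by (simp add: assms(3))
  have to_leaf: "\<exists>x\<in>X. v \<rightarrow>\<^sup>*\<^bsub>with_proj ?S\<^esub> Inr x" if "v \<in> pverts N" for v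
  proof (cases v)
    case (Inl A)
    then have "A \<in> C" using that pverts_N by auto
    then show ?thesis using Inl down member_C_nonempty member_C_subset by blast
  next
    case (Inr x)
    then have "x \<in> X" using that pverts_N by auto
    then show ?thesis using leaves Inr by blast
  qed
  have "X \<noteq> {}"
    using assms(2,3) unfolding connected_def strongly_connected_def by simp
  then have "pverts N \<noteq> {}" using pverts_N by auto
  moreover have "u \<rightarrow>\<^sup>*\<^bsub>with_proj ?S\<^esub> v" if "u \<in> pverts N" "v \<in> pverts N" for u v
    using to_leaf[OF that(1)] to_leaf[OF that(2)] leaves sym S.reachable_trans by meson
  ultimately show ?thesis
    unfolding connected_def strongly_connected_def by simp
qed

lemma (in covering_family) represents_cover_network:
  assumes "pair_graph G" "pverts G = X" "edge_clique_cover G K"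
  shows "represents N G"
proof -
  interpret G: pair_graph G by fact
  have "(x, y) \<in> parcs G \<longleftrightarrow> x \<in> X \<and> y \<in> X \<and> x \<noteq> y \<and> (\<exists>Y\<in>K. x \<in> Y \<and> y \<in> Y)" for x y
    using assms(3) G.in_arcsD1[of x y] G.in_arcsD2[of x y] G.pair_no_loops[of "(x, y)"] assms(2)
    unfolding edge_clique_cover_def clique_def by fastforce
  then have "parcs G = {(x, y). x \<in> X \<and> y \<in> X \<and> x \<noteq> y \<and> share_ancestor N (Inr x) (Inr y)}"
    using share_ancestor_N_iff by auto
  then show ?thesis
    unfolding represents_def ancestry_graph_def leaves_N
    using assms(2) by (auto intro!: pair_pre_digraph.equality)
qed

lemma (in covering_family) network_on_cover_network:
  assumes "Digraph_Component.connected (with_proj N)"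
  shows "network_on X N"
  unfolding network_on_def
proof (intro conjI ballI)
  show "pair_digraph N" "acyclic (parcs N)" "leaves N = Inr ` X"
    by (rule pair_digraph_N acyclic_N leaves_N)+
  show "Digraph_Component.connected (with_proj N)" by fact
  fix v assume v: "v \<in> pverts N"
  have "(\<exists>A\<in>C. v = Inl A) \<or> (\<exists>x\<in>X. v = Inr x)" using v pverts_N by auto
  then show "in_degree (with_proj N) v = 0 \<longrightarrow> out_degree (with_proj N) v \<ge> 2"
    "out_degree (with_proj N) v = 0 \<longrightarrow> in_degree (with_proj N) v = 1"
    "\<not> (in_degree (with_proj N) v = 1 \<and> out_degree (with_proj N) v = 1)"
    using degrees_Inl in_degree_leaf out_degree_leaf by fastforce+
qed

lemma root_above:
  assumes "pair_digraph N" "acyclic (parcs N)" "v \<in> pverts N"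
  shows "\<exists>r\<in>roots N. r \<rightarrow>\<^sup>*\<^bsub>with_proj N\<^esub> v"
proof -
  interpret pair_digraph N by fact
  have "wf (parcs N)" using finite_acyclic_wf[OF pair_finite_arcs assms(2)] .
  then show ?thesis using assms(3)
  proof (induction v rule: wf_induct_rule)
    case (less v)
    show ?case
    proof (cases "\<exists>u. (u, v) \<in> parcs N")
      case True
      then obtain u where u: "(u, v) \<in> parcs N" by blast
      then obtain r where "r \<in> roots N" "r \<rightarrow>\<^sup>*\<^bsub>with_proj N\<^esub> u"
        using less.IH in_arcsD1 by blast
      then show ?thesis using u reachable_adj_trans by blast
    next
      case False
      then have "v \<in> roots N" using less.prems by (simp add: roots_def in_degree_eq_card)
      then show ?thesis using less.prems by auto
    qed
  qed
qed

text \<open>The sets of leaves below the roots of a representing network are cliques covering all edges,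
  except that some of them may be too small to count as cliques.\<close>

lemma edge_clique_cover_of_network:
  fixes N :: "('v + 'a) pair_pre_digraph"
  assumes "network_on X N" "represents N G"
  obtains K where "edge_clique_cover G K" "card K \<le> card (roots N)"
proof
  interpret pair_digraph N using assms(1) by (simp add: network_on_def)
  have leaves: "leaves N = Inr ` X" using assms(1) by (simp add: network_on_def)
  have G: "pverts G = X"
    "(x, y) \<in> parcs G \<longleftrightarrow> x \<in> X \<and> y \<in> X \<and> x \<noteq> y \<and> share_ancestor N (Inr x) (Inr y)" for x y
    using assms(2) leaves by (auto simp: represents_def ancestry_graph_def)
  define below where "below r = {x \<in> X. r \<rightarrow>\<^sup>*\<^bsub>with_proj N\<^esub> Inr x}" for r
  have X: "finite X"
  proof -
    have "Inr ` X \<subseteq> pverts N" unfolding leaves[symmetric] leaves_def by blast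
    then have "finite (Inr ` X :: ('v + 'a) set)" using pair_finite_verts finite_subset by blast
    then show ?thesis using finite_imageD by (metis inj_Inr)
  qed
  have roots: "roots N \<subseteq> pverts N" by (auto simp: roots_def)
  then have fin: "finite (roots N)" using pair_finite_verts finite_subset by blast
  let ?K = "{Y \<in> below ` roots N. card Y \<ge> 2}"
  show "edge_clique_cover G ?K"
    unfolding edge_clique_cover_def
  proof (intro conjI ballI)
    fix Y assume "Y \<in> ?K"
    then obtain r where r: "r \<in> roots N" "Y = below r" "card Y \<ge> 2" by blast
    then show "clique G Y"
      using roots unfolding clique_def G share_ancestor_def below_def by blast
  next
    fix e assume "e \<in> parcs G"
    then obtain x y where xy: "e = (x, y)" "x \<in> X" "y \<in> X" "x \<noteq> y"
      "share_ancestor N (Inr x) (Inr y)"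
      using G(2) by (cases e) auto
    then obtain v where v: "v \<in> pverts N" "v \<rightarrow>\<^sup>*\<^bsub>with_proj N\<^esub> Inr x" "v \<rightarrow>\<^sup>*\<^bsub>with_proj N\<^esub> Inr y"
      unfolding share_ancestor_def by blast
    obtain r where r: "r \<in> roots N" "r \<rightarrow>\<^sup>*\<^bsub>with_proj N\<^esub> v"
      using root_above[OF _ _ v(1)] assms(1) by (auto simp: network_on_def)
    have b: "x \<in> below r" "y \<in> below r"
      using xy v r reachable_trans unfolding below_def by blast+
    moreover have "finite (below r)" using X by (simp add: below_def)
    ultimately have "card (below r) \<ge> 2" using card_ge_2I[of "below r" x y] xy(4) by simp
    then show "case e of (x, y) \<Rightarrow> \<exists>Y\<in>?K. x \<in> Y \<and> y \<in> Y"
      using b r xy(1) by blast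
  qed
  have "card ?K \<le> card (below ` roots N)" using fin by (intro card_mono) auto
  also have "\<dots> \<le> card (roots N)" using fin by (rule card_image_le)
  finally show "card ?K \<le> card (roots N)" .
qed

lemma minimum_edge_clique_cover_antichain:
  assumes "finite K" "edge_clique_cover G K"
    and "\<And>K'. edge_clique_cover G K' \<Longrightarrow> card K \<le> card K'"
  shows "\<not> (\<exists>A\<in>K. \<exists>B\<in>K. A \<noteq> B \<and> A \<subseteq> B)"
proof
  assume "\<exists>A\<in>K. \<exists>B\<in>K. A \<noteq> B \<and> A \<subseteq> B"
  then obtain A B where AB: "A \<in> K" "B \<in> K" "A \<noteq> B" "A \<subseteq> B" by blast
  have "\<exists>Y\<in>K - {A}. x \<in> Y \<and> y \<in> Y" if xy: "(x, y) \<in> parcs G" for x y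
  proof -
    have "\<exists>Y\<in>K. x \<in> Y \<and> y \<in> Y"
      using bspec[OF conjunct2[OF assms(2)[unfolded edge_clique_cover_def]] xy] by simp
    then obtain Y where Y: "Y \<in> K" "x \<in> Y" "y \<in> Y" by (elim bexE conjE)
    show ?thesis
    proof (cases "Y = A")
      case True
      then show ?thesis using AB Y by (intro bexI[of _ B]) auto
    next
      case False
      then show ?thesis using Y by (intro bexI[of _ Y]) auto
    qed
  qed
  then have "edge_clique_cover G (K - {A})"
    using assms(2) unfolding edge_clique_cover_def by auto
  then have "card K \<le> card (K - {A})" by (rule assms(3))
  then show False using AB(1) assms(1) card_Diff1_less by fastforce
qed

theorem theorem4p4:
  fixes G :: "'a pair_pre_digraph" and X :: "'a set" and K :: "'a set set"
  assumes "pair_graph G"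
    and "Digraph_Component.connected (with_proj G)"
    and "pverts G = X"
    and "card X \<ge> 2"
    and "edge_clique_cover G K"
  shows "network_on X (cover_network X K) \<and>
    represents (cover_network X K) G \<and>
    roots (cover_network X K) \<subseteq> Inl ` K \<and>
    (roots (cover_network X K) = Inl ` K \<longleftrightarrow>
       \<not> (\<exists>A\<in>K. \<exists>B\<in>K. A \<noteq> B \<and> A \<subseteq> B)) \<and>
    ((\<forall>K'. edge_clique_cover G K' \<longrightarrow> card K \<le> card K') \<longrightarrow>
       card K = ecc G \<and>
       roots (cover_network X K) = Inl ` K \<and>
       (\<forall>N :: ('v + 'a) pair_pre_digraph.
          network_on X N \<and> represents N G \<longrightarrow>
          card (roots (cover_network X K)) \<le> card (roots N)))"
proof -
  interpret covering_family X K
  proof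
    show "finite X" using assms(4) card.infinite by fastforce
    show "\<Union>K = X" using connected_edge_clique_cover_Union assms by metis
    show "card Y \<ge> 2" if "Y \<in> K" for Y
      using that assms(5) unfolding edge_clique_cover_def clique_def by blast
  qed
  have finK: "finite K" using K_subset_C finite_C finite_subset by blast
  show ?thesis
  proof (intro conjI impI allI)
    show "network_on X (cover_network X K)"
      by (intro network_on_cover_network connected_cover_network) (use assms in blast)+
    show "represents (cover_network X K) G"
      using represents_cover_network assms by blast
    show "roots (cover_network X K) \<subseteq> Inl ` K"
      unfolding roots_N by blast
    show "roots (cover_network X K) = Inl ` K \<longleftrightarrow> \<not> (\<exists>A\<in>K. \<exists>B\<in>K. A \<noteq> B \<and> A \<subseteq> B)"
      by (rule roots_N_eq_iff)
  next
    assume min: "\<forall>K'. edge_clique_cover G K' \<longrightarrow> card K \<le> card K'"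
    show "card K = ecc G"
      unfolding ecc_def by (rule Least_equality[symmetric]) (use assms(5) min in blast)+
    show roots: "roots (cover_network X K) = Inl ` K"
      using minimum_edge_clique_cover_antichain[OF finK assms(5)] min roots_N_eq_iff by blast
    fix N' :: "('v + 'a) pair_pre_digraph"
    assume "network_on X N' \<and> represents N' G"
    then obtain K' where "edge_clique_cover G K'" "card K' \<le> card (roots N')"
      using edge_clique_cover_of_network by blast
    then have "card K \<le> card (roots N')" using min order_trans by blast
    then show "card (roots (cover_network X K)) \<le> card (roots N')"
      unfolding roots by (simp add: card_image)
  qed
qed

end
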